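(* Let $n\ge 2$ be an integer, let $F$ be the discrete Fourier transform matrix of order $n$, and let $C=\mathrm{circ}_n(c_0,c_1,\ldots,c_{n-1})$ be any complex circulant matrix (not necessarily Hermitian) such that $c_0=1$, $|c_j|=1$ for all $j=1,\ldots,n-1$, and $CC^*=nI$. Then the identity matrix $I$, the matrix $F$, and the normalized matrix $\frac{1}{\sqrt n}C$ define a set of three (pairwise) mutually unbiased bases in dimension $n$, the vectors of each basis being the columns of the respective matrix.
   Context: $\mathrm{circ}_n(c_0,c_1,\ldots,c_{n-1})$ denotes the $n\times n$ circulant matrix with first row $(c_0,c_1,\ldots,c_{n-1})$, i.e. with rows and columns indexed by $0,\ldots,n-1$ its $(r,s)$ entry is $c_{(s-r)\bmod n}$. $C^*$ is the conjugate transpose. The discrete Fourier transform matrix of order $n$ is the unitary matrix $F$ with entries $F_{jk}=\frac{1}{\sqrt n}\omega^{jk}$, $j,k=0,\ldots,n-1$, where $\omega=\mathrm{e}^{2\pi\mathrm{i}/n}$. Two orthonormal bases $\{\phi_j\}_{j=0}^{n-1}$ and $\{\psi_k\}_{k=0}^{n-1}$ of $\mathbb{C}^n$ are mutually unbiased if $|\langle\phi_j|\psi_k\rangle|^2=\frac1n$ for all $j,k=0,\ldots,n-1$. A unitary matrix is identified with the orthonormal basis formed by its columns. *)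

theory Defs
  imports Complex_Main "Jordan_Normal_Form.Schur_Decomposition"
begin

definition circ_mat :: "nat \<Rightarrow> (nat \<Rightarrow> complex) \<Rightarrow> complex mat" where
  "circ_mat n c = mat n n (\<lambda>(r, s). c (nat ((int s - int r) mod int n)))"

definition dft_mat :: "nat \<Rightarrow> complex mat" where
  "dft_mat n = mat n n (\<lambda>(j, k).
     complex_of_real (1 / sqrt (real n)) *
     exp (2 * complex_of_real pi * \<i> / of_nat n) ^ (j * k))"

(* The product v \<bullet>c w conjugates its second argument, whereas the bracket
   is conjugate-linear in the first. *)
definition braket :: "complex vec \<Rightarrow> complex vec \<Rightarrow> complex" where
  "braket \<phi> \<psi> = \<psi> \<bullet>c \<phi>"

(* A basis is a family indexed by the naturals below n; values at other indices are irrelevant. *)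
definition orthonormal_basis :: "nat \<Rightarrow> (nat \<Rightarrow> complex vec) \<Rightarrow> bool" where
  "orthonormal_basis n \<phi> \<longleftrightarrow>
     vectorspace.basis class_ring (module_vec TYPE(complex) n) (\<phi> ` {..<n}) \<and>
     (\<forall>i<n. \<forall>j<n. braket (\<phi> i) (\<phi> j) = (if i = j then 1 else 0))"

definition mutually_unbiased_bases ::
    "nat \<Rightarrow> (nat \<Rightarrow> complex vec) \<Rightarrow> (nat \<Rightarrow> complex vec) \<Rightarrow> bool" where
  "mutually_unbiased_bases n \<phi> \<psi> \<longleftrightarrow>
     orthonormal_basis n \<phi> \<and> orthonormal_basis n \<psi> \<and>
     (\<forall>j<n. \<forall>k<n. (cmod (braket (\<phi> j) (\<psi> k)))\<^sup>2 = 1 / real n)"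

end

theory Submission
  imports Defs
begin

text \<open>Every column of the Fourier matrix is an eigenvector of every circulant matrix, so the
  modulus of its inner product with the \<open>k\<close>-th column of \<open>C\<close> does not depend on \<open>k\<close>. By Parseval's
  identity for the unitary matrix \<open>C / sqrt n\<close> the squares of these \<open>n\<close> equal moduli add up to 1.\<close>

section \<open>Adjoints, brackets of columns, and bases from unitary matrices\<close>

lemma mat_adjoint_dim [simp]:
  "dim_row (mat_adjoint A) = dim_col A" "dim_col (mat_adjoint A) = dim_row A"
  by (simp_all add: mat_adjoint_def)

lemma index_mat_adjoint [simp]:
  "i < dim_col A \<Longrightarrow> j < dim_row A \<Longrightarrow> mat_adjoint A $$ (i, j) = conjugate (A $$ (j, i))"
  by (simp add: mat_adjoint_def mat_of_rows_def)

lemma mat_adjoint_smult: "mat_adjoint (a \<cdot>\<^sub>m A) = conjugate a \<cdot>\<^sub>m mat_adjoint A"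
  by (rule eq_matI) (simp_all add: conjugate_dist_mul)

lemma braket_eq_sum:
  "dim_vec \<phi> = n \<Longrightarrow> braket \<phi> \<psi> = (\<Sum>r<n. cnj (\<phi> $ r) * \<psi> $ r)"
  by (simp add: braket_def scalar_prod_def atLeast0LessThan mult.commute)

lemma braket_col:
  assumes "A \<in> carrier_mat n m" "B \<in> carrier_mat n p" "i < m" "j < p"
  shows "braket (col A i) (col B j) = (\<Sum>r<n. cnj (A $$ (r, i)) * B $$ (r, j))"
  using assms by (subst braket_eq_sum) auto

text \<open>The entries of \<open>mat_adjoint U * U\<close> are the brackets of the columns, which
  gives orthonormality. The determinant of \<open>U\<close> is a unit, so the columns are
  independent, and \<open>n\<close> independent vectors span.\<close>

lemma orthonormal_basis_col:
  assumes U: "U \<in> carrier_mat n n" and inv: "mat_adjoint U * U = 1\<^sub>m n"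
  shows "orthonormal_basis n (col U)"
proof -
  interpret vec_space "TYPE(complex)" n .
  have adj: "mat_adjoint U \<in> carrier_mat n n"
    using U by auto
  have braket: "braket (col U i) (col U j) = (if i = j then 1 else 0)"
    if "i < n" "j < n" for i j
  proof -
    have "braket (col U i) (col U j) = (mat_adjoint U * U) $$ (i, j)"
      using U that by (simp add: braket_col[OF U U] scalar_prod_def atLeast0LessThan)
    with that show ?thesis
      by (simp add: inv)
  qed
  have "det (mat_adjoint U) * det U = 1"
    using det_mult[OF adj U] inv by simp
  then have "lin_indpt (set (cols U))"
    using lin_dep_cols_imp_det_0[OF U] by auto
  \<comment> \<open>Independence is a property of the set of columns and says nothing about
    repetitions. A repeated column would have a bracket equal to both 1 and 0, so the set has
    exactly \<open>n\<close> elements.\<close>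
  moreover have "inj_on (col U) {..<n}"
    by (rule inj_onI) (metis braket lessThan_iff zero_neq_one)
  then have "card (col U ` {..<n}) = n"
    by (simp add: card_image)
  moreover have "set (cols U) = col U ` {..<n}"
    using U by (simp add: cols_def atLeast0LessThan)
  moreover have "col U ` {..<n} \<subseteq> carrier_vec n"
    using U by auto
  ultimately have "basis (col U ` {..<n})"
    by (intro dim_li_is_basis) (auto simp: dim_is_n)
  then show ?thesis
    using braket by (simp add: orthonormal_basis_def)
qed

text \<open>Expanding the squares gives a triple sum. With the sum over \<open>k\<close> moved
  innermost, orthonormality of the rows of \<open>U\<close> leaves only the diagonal terms
  \<open>r = s\<close>.\<close>

lemma parseval_col:
  assumes U: "U \<in> carrier_mat n n" and inv: "U * mat_adjoint U = 1\<^sub>m n"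
    and v: "v \<in> carrier_vec n"
  shows "complex_of_real (\<Sum>k<n. (cmod (braket v (col U k)))\<^sup>2) = braket v v"
proof -
  have rows: "(\<Sum>k<n. U $$ (r, k) * cnj (U $$ (s, k))) = (if r = s then 1 else 0)"
    if "r < n" "s < n" for r s
  proof -
    have "(\<Sum>k<n. U $$ (r, k) * cnj (U $$ (s, k))) = (U * mat_adjoint U) $$ (r, s)"
      using U that by (simp add: scalar_prod_def atLeast0LessThan)
    with that show ?thesis
      by (simp add: inv)
  qed
  have br: "braket v (col U k) = (\<Sum>r<n. cnj (v $ r) * U $$ (r, k))" if "k < n" for k
    using U v that by (subst braket_eq_sum) auto
  have "complex_of_real (\<Sum>k<n. (cmod (braket v (col U k)))\<^sup>2)
      = (\<Sum>k<n. braket v (col U k) * cnj (braket v (col U k)))"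
    by (simp only: of_real_sum complex_norm_square)
  also have "\<dots> = (\<Sum>k<n. \<Sum>r<n. \<Sum>s<n.
      cnj (v $ r) * v $ s * (U $$ (r, k) * cnj (U $$ (s, k))))"
  proof (rule sum.cong [OF refl])
    fix k assume "k \<in> {..<n}"
    then have k: "k < n" by simp
    show "braket v (col U k) * cnj (braket v (col U k))
        = (\<Sum>r<n. \<Sum>s<n. cnj (v $ r) * v $ s * (U $$ (r, k) * cnj (U $$ (s, k))))"
      unfolding br[OF k] cnj_sum sum_product by (intro sum.cong refl) (simp add: mult_ac)
  qed
  also have "\<dots> = (\<Sum>r<n. \<Sum>k<n. \<Sum>s<n.
      cnj (v $ r) * v $ s * (U $$ (r, k) * cnj (U $$ (s, k))))"
    by (rule sum.swap)
  also have "\<dots> = (\<Sum>r<n. \<Sum>s<n. \<Sum>k<n.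
      cnj (v $ r) * v $ s * (U $$ (r, k) * cnj (U $$ (s, k))))"
    by (intro sum.cong refl sum.swap)
  also have "\<dots> = (\<Sum>r<n. \<Sum>s<n. cnj (v $ r) * v $ s * (if r = s then 1 else 0))"
    by (intro sum.cong refl) (simp add: rows flip: sum_distrib_left)
  also have "\<dots> = (\<Sum>r<n. cnj (v $ r) * v $ r)"
    by (intro sum.cong refl) (simp add: if_distrib[of "\<lambda>x. _ * x"] cong: if_cong)
  also have "\<dots> = braket v v"
    using v by (simp add: braket_eq_sum)
  finally show ?thesis .
qed

text \<open>A bracket with a standard basis vector reads off an entry of \<open>U\<close>, so
  flatness of the entries is exactly unbiasedness. This serves both the Fourier matrix and the
  normalized circulant matrix.\<close>

lemma mutually_unbiased_one_mat:
  assumes "U \<in> carrier_mat n n" "mat_adjoint U * U = 1\<^sub>m n"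
    and "\<And>j k. j < n \<Longrightarrow> k < n \<Longrightarrow> cmod (U $$ (j, k)) = 1 / sqrt (real n)"
  shows "mutually_unbiased_bases n (col (1\<^sub>m n)) (col U)"
proof -
  have "mat_adjoint (1\<^sub>m n) * 1\<^sub>m n = (1\<^sub>m n :: complex mat)"
    by (rule eq_matI) (auto simp: scalar_prod_def if_distrib cong: if_cong)
  then have "orthonormal_basis n (col (1\<^sub>m n))"
    by (intro orthonormal_basis_col) auto
  moreover have "braket (col (1\<^sub>m n) j) (col U k) = U $$ (j, k)" if "j < n" "k < n" for j k
  proof -
    have "braket (col (1\<^sub>m n) j) (col U k) = (\<Sum>r<n. cnj (1\<^sub>m n $$ (r, j)) * U $$ (r, k))"
      using assms(1) that by (intro braket_col) auto
    also have "\<dots> = (\<Sum>r<n. if r = j then U $$ (r, k) else 0)"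
      using that by (intro sum.cong) auto
    finally show ?thesis
      using that by simp
  qed
  ultimately show ?thesis
    using assms orthonormal_basis_col by (simp add: mutually_unbiased_bases_def power_divide)
qed

section \<open>Roots of unity and the Fourier matrix\<close>

lemma power_mod_root_unity:
  fixes w :: "'a::monoid_mult"
  assumes "w ^ n = 1"
  shows "w ^ (m mod n) = w ^ m"
proof -
  have "w ^ m = w ^ (n * (m div n) + m mod n)"
    by simp
  also have "\<dots> = w ^ (m mod n)"
    unfolding power_add power_mult assms by simp
  finally show ?thesis
    by simp
qed

lemma norm_root_unity:
  fixes w :: "'a::real_normed_div_algebra"
  assumes "w ^ n = 1" "n > 0"
  shows "norm w = 1"
  using assms by (metis norm_ge_zero norm_one norm_power power_eq_1_iff zero_less_iff_neq_zero)

definition dft_root :: "nat \<Rightarrow> complex" where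
  "dft_root n = exp (2 * complex_of_real pi * \<i> / of_nat n)"

lemma dft_root_power: "dft_root n ^ k = cis (2 * pi * real k / real n)"
  by (simp add: dft_root_def cis_conv_exp field_simps flip: exp_of_nat_mult)

lemma dft_root_power_order: "n > 0 \<Longrightarrow> dft_root n ^ n = 1"
  by (simp add: dft_root_power)

lemma norm_dft_root [simp]: "cmod (dft_root n) = 1"
  using dft_root_power[of n 1] by (simp only: power_one_right norm_cis)

text \<open>This is primitivity of the root, read off from the enumeration of all
  \<open>n\<close>-th roots of unity. It is what makes distinct Fourier columns orthogonal.\<close>

lemma inj_on_dft_root_power: "n > 0 \<Longrightarrow> inj_on (\<lambda>k. dft_root n ^ k) {..<n}"
  using bij_betw_roots_unity[of n] by (simp add: dft_root_power bij_betw_def)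

lemma dft_mat_carrier [simp]: "dft_mat n \<in> carrier_mat n n"
  by (simp add: dft_mat_def)

lemma index_dft_mat:
  "j < n \<Longrightarrow> k < n \<Longrightarrow> dft_mat n $$ (j, k) = complex_of_real (1 / sqrt (real n)) * dft_root n ^ (j * k)"
  by (simp add: dft_mat_def dft_root_def)

text \<open>Each entry of the product is \<open>1 / n\<close> times a geometric sum whose ratio is
  an \<open>n\<close>-th root of unity. The ratio is 1 only on the diagonal, and elsewhere the sum
  vanishes.\<close>

lemma dft_mat_unitary:
  assumes "n > 0"
  shows "mat_adjoint (dft_mat n) * dft_mat n = 1\<^sub>m n"
proof (rule eq_matI)
  fix i j assume "i < dim_row (1\<^sub>m n :: complex mat)" "j < dim_col (1\<^sub>m n :: complex mat)"
  then have ij: "i < n" "j < n" by simp_all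
  let ?w = "dft_root n"
  \<comment> \<open>As \<open>?w\<close> has modulus 1, conjugation inverts it: \<open>q\<close> is
    the power with exponent \<open>j - i\<close>, written without a negative exponent.\<close>
  define q where "q = cnj (?w ^ i) * ?w ^ j"
  have unit: "?w ^ i * cnj (?w ^ i) = 1"
    using complex_norm_square[of "?w ^ i"] by (simp add: norm_power)
  have "(mat_adjoint (dft_mat n) * dft_mat n) $$ (i, j)
      = (\<Sum>r<n. cnj (dft_mat n $$ (r, i)) * dft_mat n $$ (r, j))"
    using ij carrier_matD[OF dft_mat_carrier[of n]] by (simp add: scalar_prod_def atLeast0LessThan)
  also have "\<dots> = (\<Sum>r<n. (1 / of_nat n) * q ^ r)"
  proof (intro sum.cong refl)
    fix r assume "r \<in> {..<n}"
    moreover have "complex_of_real (sqrt (real n)) * complex_of_real (sqrt (real n)) = of_nat n"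
      by (simp flip: of_real_mult)
    ultimately show "cnj (dft_mat n $$ (r, i)) * dft_mat n $$ (r, j) = (1 / of_nat n) * q ^ r"
      using ij by (simp add: index_dft_mat q_def power_mult_distrib field_simps flip: power_mult)
  qed
  also have "\<dots> = (1 / of_nat n) * (\<Sum>r<n. q ^ r)"
    by (simp add: sum_distrib_left)
  also have "\<dots> = (if i = j then 1 else 0)"
  proof (cases "i = j")
    case True
    then have "q = 1"
      using unit by (simp add: q_def mult.commute)
    with True assms show ?thesis by simp
  next
    case False
    have "q \<noteq> 1"
    proof
      assume "q = 1"
      then have "?w ^ i = ?w ^ i * cnj (?w ^ i) * ?w ^ j"
        by (simp add: q_def mult.assoc)
      then have "?w ^ i = ?w ^ j"
        by (simp only: unit mult_1_left)
      then show False
        using inj_on_dft_root_power[OF assms] ij False by (auto dest: inj_onD)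
    qed
    moreover have "q ^ n = cnj ((?w ^ n) ^ i) * (?w ^ n) ^ j"
      by (simp add: q_def power_mult_distrib mult.commute flip: power_mult)
    then have "q ^ n = 1"
      using assms by (simp add: dft_root_power_order)
    ultimately show ?thesis
      using False by (simp add: geometric_sum)
  qed
  finally show "(mat_adjoint (dft_mat n) * dft_mat n) $$ (i, j) = 1\<^sub>m n $$ (i, j)"
    using ij by simp
qed (use carrier_matD[OF dft_mat_carrier[of n]] in simp_all)

section \<open>Circulant matrices and their Fourier eigenvectors\<close>

lemma circ_mat_carrier [simp]: "circ_mat n c \<in> carrier_mat n n"
  by (simp add: circ_mat_def)

lemma index_circ_mat:
  "r < n \<Longrightarrow> s < n \<Longrightarrow> circ_mat n c $$ (r, s) = c (nat ((int s - int r) mod int n))"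
  by (simp add: circ_mat_def)

text \<open>The conjugated powers of \<open>w\<close> form a left eigenvector of the circulant
  matrix, with eigenvalue \<open>\<Sum>m<n. c m * w ^ m\<close>. This follows by substituting
  \<open>m\<close> for \<open>k - r\<close> modulo \<open>n\<close>.\<close>

lemma sum_circulant_root_unity:
  fixes w :: complex
  assumes w: "w ^ n = 1" and k: "k < n"
  shows "(\<Sum>r<n. cnj (w ^ r) * c (nat ((int k - int r) mod int n)))
       = cnj (w ^ k) * (\<Sum>m<n. c m * w ^ m)"
proof -
  define d where "d = (\<lambda>r. nat ((int k - int r) mod int n))"
  have n: "n > 0"
    using k by simp
  have d_less: "d r < n" for r
    using n by (simp add: d_def nat_less_iff)
  have int_d: "int (d r) = (int k - int r) mod int n" for r
    using n by (simp add: d_def)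
  \<comment> \<open>The reflection \<open>d\<close> is an involution on the indices below
    \<open>n\<close>, so it is both maps of the reindexing below.\<close>
  have dd: "d (d r) = r" if "r < n" for r
  proof -
    have "int (d (d r)) = int r"
      using that by (simp add: int_d mod_diff_right_eq)
    then show ?thesis by simp
  qed
  have unit: "cnj w * w = 1"
    using norm_root_unity[OF w n] complex_norm_square[of w] by (simp add: mult.commute)
  \<comment> \<open>The exponents \<open>d r + r\<close> and \<open>k\<close> agree modulo
    \<open>n\<close>, so \<open>w ^ k\<close> splits as \<open>w ^ d r * w ^ r\<close>. Multiplying
    by conjugate powers and cancelling \<open>cnj w * w\<close> moves the factors across.\<close>
  have cnj_pow: "cnj (w ^ r) = cnj (w ^ k) * w ^ d r" for r
  proof -
    have "int ((d r + r) mod n) = int k"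
      using k by (simp add: zmod_int int_d mod_simps)
    then have "w ^ k = w ^ (d r + r)"
      by (metis of_nat_eq_iff power_mod_root_unity[OF w])
    then have "cnj (w ^ r) * w ^ k = w ^ d r * (cnj w * w) ^ r"
      by (simp only: power_add power_mult_distrib complex_cnj_power mult_ac)
    then have "w ^ d r = cnj (w ^ r) * w ^ k"
      by (simp add: unit)
    then have "cnj (w ^ k) * w ^ d r = cnj (w ^ r) * (cnj w * w) ^ k"
      by (simp only: power_mult_distrib complex_cnj_power mult_ac)
    then show ?thesis
      by (simp add: unit)
  qed
  have "(\<Sum>r<n. cnj (w ^ r) * c (d r)) = cnj (w ^ k) * (\<Sum>r<n. c (d r) * w ^ d r)"
    by (subst cnj_pow) (simp add: sum_distrib_left mult_ac)
  also have "(\<Sum>r<n. c (d r) * w ^ d r) = (\<Sum>m<n. c m * w ^ m)"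
    by (rule sum.reindex_bij_witness[of _ d d]) (auto simp: d_less dd)
  finally show ?thesis
    by (simp add: d_def)
qed

text \<open>The column index \<open>k\<close> enters the bracket only through the phase
  \<open>cnj (w ^ k)\<close>, so it disappears from the modulus. The factor \<open>a\<close> allows
  for the normalization of the circulant matrix.\<close>

lemma norm_braket_dft_circ:
  assumes "j < n" "k < n"
  shows "cmod (braket (col (dft_mat n) j) (col (a \<cdot>\<^sub>m circ_mat n c) k))
       = cmod a / sqrt (real n) * cmod (\<Sum>m<n. c m * dft_root n ^ (j * m))"
proof -
  define w where "w = dft_root n ^ j"
  have wn: "w ^ n = 1"
    using assms dft_root_power_order[of n]
    by (metis gr_zeroI mult.commute not_less_zero power_mult power_one w_def)
  have "braket (col (dft_mat n) j) (col (a \<cdot>\<^sub>m circ_mat n c) k)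
      = (\<Sum>r<n. cnj (dft_mat n $$ (r, j)) * (a \<cdot>\<^sub>m circ_mat n c) $$ (r, k))"
    using assms by (intro braket_col[of _ n n _ n]) simp_all
  also have "\<dots> = a * complex_of_real (1 / sqrt (real n)) *
      (\<Sum>r<n. cnj (w ^ r) * c (nat ((int k - int r) mod int n)))"
    unfolding sum_distrib_left
    using assms carrier_matD[OF circ_mat_carrier[of n c]]
    by (intro sum.cong refl)
      (simp add: index_dft_mat index_circ_mat w_def mult_ac flip: power_mult)
  also have "\<dots> = a * complex_of_real (1 / sqrt (real n)) *
      (cnj (w ^ k) * (\<Sum>m<n. c m * w ^ m))"
    by (simp only: sum_circulant_root_unity[OF wn assms(2)])
  also have "cmod \<dots> = cmod a / sqrt (real n) * cmod (\<Sum>m<n. c m * w ^ m)"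
    by (simp add: norm_mult norm_divide norm_power w_def)
  finally show ?thesis
    by (simp add: w_def power_mult)
qed

section \<open>Unbiasedness of the three pairs of bases\<close>

theorem proposition8:
  fixes n :: nat and c :: "nat \<Rightarrow> complex" and C :: "complex mat"
  assumes "n \<ge> 2"
    and "C = circ_mat n c"
    and "c 0 = 1"
    and "\<forall>j\<in>{1..n - 1}. cmod (c j) = 1"
    and "C * mat_adjoint C = of_nat n \<cdot>\<^sub>m 1\<^sub>m n"
  shows "mutually_unbiased_bases n (col (1\<^sub>m n)) (col (dft_mat n)) \<and>
         mutually_unbiased_bases n (col (1\<^sub>m n))
           (col (complex_of_real (1 / sqrt (real n)) \<cdot>\<^sub>m C)) \<and>
         mutually_unbiased_bases n (col (dft_mat n))
           (col (complex_of_real (1 / sqrt (real n)) \<cdot>\<^sub>m C))"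
proof -
  define U where "U = complex_of_real (1 / sqrt (real n)) \<cdot>\<^sub>m C"
  let ?F = "dft_mat n"
  have n: "n > 0" and sq: "complex_of_real (sqrt (real n)) * complex_of_real (sqrt (real n)) = of_nat n"
    using assms(1) by (simp_all flip: of_real_mult)
  have C: "C \<in> carrier_mat n n"
    by (simp add: assms(2))
  then have U: "U \<in> carrier_mat n n" and adj: "mat_adjoint U \<in> carrier_mat n n"
    by (auto simp: U_def)
  have "mat_adjoint C \<in> carrier_mat n n"
    using C by auto
  \<comment> \<open>The scalar is real, so the adjoint keeps it, and its two copies multiply to
    \<open>1 / n\<close>.\<close>
  then have "U * mat_adjoint U
      = complex_of_real (1 / sqrt (real n)) \<cdot>\<^sub>m
          (complex_of_real (1 / sqrt (real n)) \<cdot>\<^sub>m (C * mat_adjoint C))"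
    using C by (simp add: U_def mat_adjoint_smult mult_smult_assoc_mat[of _ n n _ n]
        mult_smult_distrib[of _ n n _ n])
  also have "\<dots> = 1\<^sub>m n"
    using n sq by (intro eq_matI) (auto simp: assms(5) field_simps)
  finally have inv: "U * mat_adjoint U = 1\<^sub>m n" .
  \<comment> \<open>A one-sided inverse of a square matrix is two-sided. The columns form an
    orthonormal basis by this product, while Parseval uses the other one.\<close>
  then have inv': "mat_adjoint U * U = 1\<^sub>m n"
    by (rule mat_mult_left_right_inverse[OF U adj])
  have "cmod (?F $$ (j, k)) = 1 / sqrt (real n)" if "j < n" "k < n" for j k
    using that by (simp add: index_dft_mat norm_mult norm_divide norm_power)
  then have IF: "mutually_unbiased_bases n (col (1\<^sub>m n)) (col ?F)"
    by (intro mutually_unbiased_one_mat dft_mat_unitary n) simp_all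
  have "cmod (c m) = 1" if "m < n" for m
    using that assms(3,4) by (cases "m = 0") auto
  moreover have "nat ((int k - int j) mod int n) < n" for j k
    using n by (simp add: nat_less_iff)
  ultimately have "cmod (U $$ (j, k)) = 1 / sqrt (real n)" if "j < n" "k < n" for j k
    using that carrier_matD[OF circ_mat_carrier[of n c]]
    by (simp add: U_def assms(2) index_circ_mat norm_mult norm_divide)
  then have IU: "mutually_unbiased_bases n (col (1\<^sub>m n)) (col U)"
    by (intro mutually_unbiased_one_mat U inv')
  have "(cmod (braket (col ?F j) (col U k)))\<^sup>2 = 1 / real n" if jk: "j < n" "k < n" for j k
  proof -
    have const: "cmod (braket (col ?F j) (col U l)) = cmod (braket (col ?F j) (col U k))"
      if "l < n" for l
      using jk that by (simp add: U_def assms(2) norm_braket_dft_circ)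
    have "braket (col ?F j) (col ?F j) = 1"
      using orthonormal_basis_col[OF dft_mat_carrier dft_mat_unitary[OF n]] jk
      by (simp add: orthonormal_basis_def)
    moreover have "col ?F j \<in> carrier_vec n"
      using carrier_matD(1)[OF dft_mat_carrier[of n]] by (metis col_dim)
    ultimately have "complex_of_real (\<Sum>l<n. (cmod (braket (col ?F j) (col U l)))\<^sup>2) = 1"
      using parseval_col[OF U inv] by simp
    then have "(\<Sum>l<n. (cmod (braket (col ?F j) (col U l)))\<^sup>2) = 1"
      by (simp only: of_real_eq_1_iff)
    \<comment> \<open>By \<open>const\<close>, all \<open>n\<close> summands equal the one at
      \<open>k\<close>.\<close>
    then have "real n * (cmod (braket (col ?F j) (col U k)))\<^sup>2 = 1"
      by (simp add: const)
    with n show ?thesis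
      by (simp add: field_simps)
  qed
  then have "mutually_unbiased_bases n (col ?F) (col U)"
    using IF IU by (simp add: mutually_unbiased_bases_def)
  with IF IU show ?thesis
    by (simp add: U_def)
qed

end
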